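(* It is impossible to extend the equivalence $$|f|\in\Lambda_{\omega_{\alpha},\infty}(\mathbb{D})\Leftrightarrow f\in\Lambda_{\omega_{\alpha},\infty}(\mathbb{D}),$$ which is known for $\alpha\in(0,1]$, to the whole $\Lambda_{\omega_{\alpha},\infty}(\mathbb{D})$-scale with $\alpha\in(0,\infty)$ unless the analytic function $f$ is a constant.
   Context: $\mathbb{D}=\{z\in\mathbb{C}:|z|<1\}$ is the unit disk. For a constant $\alpha>0$, $\omega_{\alpha}(t)=t^{\alpha}$ for $t\geq 0$. A Borel function $F$ of $\mathbb{D}$ into $\mathbb{C}$ belongs to $\Lambda_{\omega_{\alpha},\infty}(\mathbb{D})$ if there is a positive constant $M$ such that $|F(z_{1})-F(z_{2})|\leq M|z_{1}-z_{2}|^{\alpha}$ for all $z_{1},z_{2}\in\mathbb{D}$. For $\alpha\in(0,1]$ the displayed equivalence is a known result of Dyakonov for functions $f$ in the disk algebra (analytic in $\mathbb{D}$ and continuous up to the boundary). Dyakonov posed as an open problem how to extend it to the whole scale $\alpha\in(0,\infty)$, and the statement is given as an answer to that problem.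
   Formalization: Read literally, the claim fails: for f(z)=z the equivalence holds for every α (for α>1 both sides are false). What is proved: for nonconstant analytic f, neither |f| nor f belongs to the class for any α>1, while for constant f both belong for all α>0. *)

theory Defs
  imports "HOL-Complex_Analysis.Complex_Analysis"
begin

abbreviation unit_disk :: "complex set" where
  "unit_disk \<equiv> ball 0 1"

definition omega :: "real \<Rightarrow> real \<Rightarrow> real" where
  "omega \<alpha> t = t powr \<alpha>"

text \<open>A function on the disk is represented by a total function on the complex plane, of
  which only the restriction to the disk matters.\<close>

definition Lambda_infty :: "(real \<Rightarrow> real) \<Rightarrow> (complex \<Rightarrow> complex) set" where
  "Lambda_infty \<omega> =
     {F. F \<in> borel_measurable (restrict_space borel unit_disk) \<and>
         (\<exists>M>0. \<forall>z1\<in>unit_disk. \<forall>z2\<in>unit_disk. norm (F z1 - F z2) \<le> M * \<omega> (norm (z1 - z2)))}"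

text \<open>The modulus of \<open>f\<close> as a complex-valued function, so that it can be a member of the
  same class as \<open>f\<close>.\<close>

definition modulus :: "(complex \<Rightarrow> complex) \<Rightarrow> complex \<Rightarrow> complex" where
  "modulus f = (\<lambda>z. complex_of_real (norm (f z)))"

end

theory Submission
  imports Defs
begin

text \<open>For \<open>\<alpha> > 1\<close> the condition \<open>\<bar>F x - F y\<bar> \<le> M \<bar>x - y\<bar>\<^sup>\<alpha>\<close> makes all difference quotients
  tend to zero, so the derivative of \<open>F\<close> vanishes identically, and on a convex set \<open>F\<close> is
  constant (\<open>holder_exponent_gt_1_constant_on\<close>).  The argument rests on that
  condition alone, so it applies to \<open>\<bar>f\<bar>\<close> as well as to \<open>f\<close>.  Analyticity enters in the passage
  from a constant modulus to a constant function, by the maximum modulus principle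
  (\<open>holomorphic_constant_norm_imp_constant_on\<close>).
  Conversely, constant functions satisfy the condition for every exponent.\<close>

lemma holder_exponent_gt_1_constant_on:
  fixes F :: "'a::real_normed_vector \<Rightarrow> 'b::real_normed_vector"
  assumes "convex S" and "\<alpha> > 1"
    and holder: "\<And>x y. x \<in> S \<Longrightarrow> y \<in> S \<Longrightarrow> norm (F x - F y) \<le> M * norm (x - y) powr \<alpha>"
  shows "F constant_on S"
proof -
  have "(F has_derivative (\<lambda>h. 0)) (at x within S)" if "x \<in> S" for x
  proof (rule has_derivativeI_sandwich[where e = 1 and H = "\<lambda>y. M * norm (y - x) powr (\<alpha> - 1)"])
    fix y assume y: "y \<in> S" "y \<noteq> x" "dist y x < 1"
    have "norm (F y - F x) \<le> M * norm (y - x) powr \<alpha>"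
      using holder y that by blast
    also have "norm (y - x) powr \<alpha> = norm (y - x) powr (\<alpha> - 1) * norm (y - x)"
      using y by (simp add: powr_diff)
    finally show "norm (F y - F x - 0) / norm (y - x) \<le> M * norm (y - x) powr (\<alpha> - 1)"
      using y by (simp add: divide_le_eq mult.assoc)
  next
    have "((\<lambda>y. norm (y - x)) \<longlongrightarrow> 0) (at x within S)"
      by (intro tendsto_eq_intros) auto
    then have "((\<lambda>y. norm (y - x) powr (\<alpha> - 1)) \<longlongrightarrow> 0 powr (\<alpha> - 1)) (at x within S)"
      using \<open>\<alpha> > 1\<close> by (intro tendsto_powr') (auto intro!: tendsto_const)
    then show "((\<lambda>y. M * norm (y - x) powr (\<alpha> - 1)) \<longlongrightarrow> 0) (at x within S)"
      by (auto intro: tendsto_mult_right_zero)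
  qed auto
  then have "\<exists>c. \<forall>x\<in>S. F x = c"
    using has_derivative_zero_constant[OF \<open>convex S\<close>, of F] by blast
  then show ?thesis
    by (simp add: constant_on_def)
qed

lemma Lambda_infty_gt_1_constant_on:
  assumes "\<alpha> > 1" and "F \<in> Lambda_infty (omega \<alpha>)"
  shows "F constant_on unit_disk"
proof -
  obtain M where "\<And>x y. x \<in> unit_disk \<Longrightarrow> y \<in> unit_disk \<Longrightarrow>
      norm (F x - F y) \<le> M * norm (x - y) powr \<alpha>"
    using assms(2) unfolding Lambda_infty_def omega_def by blast
  then show ?thesis
    using holder_exponent_gt_1_constant_on[OF convex_ball \<open>\<alpha> > 1\<close>] by blast
qed

text \<open>Where the modulus is constant, every point is a maximum of it.\<close>

lemma holomorphic_constant_norm_imp_constant_on: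
  assumes "f holomorphic_on S" and "open S" and "connected S"
    and "(\<lambda>z. norm (f z)) constant_on S"
  shows "f constant_on S"
proof (cases "S = {}")
  case True
  then show ?thesis by (simp add: constant_on_def)
next
  case False
  then obtain a where "a \<in> S" by blast
  moreover have "norm (f z) \<le> norm (f a)" if "z \<in> S" for z
    using assms(4) that \<open>a \<in> S\<close> unfolding constant_on_def by force
  ultimately show ?thesis
    using maximum_modulus_principle[of f S S a] assms by blast
qed

lemma constant_on_imp_Lambda_infty:
  assumes "F constant_on unit_disk"
  shows "F \<in> Lambda_infty (omega \<alpha>)"
proof -
  obtain c where c: "\<And>z. z \<in> unit_disk \<Longrightarrow> F z = c"
    using assms unfolding constant_on_def by blast
  have "F \<in> borel_measurable (restrict_space borel unit_disk) \<longleftrightarrow>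
        (\<lambda>_. c) \<in> borel_measurable (restrict_space borel unit_disk)"
    by (rule measurable_cong) (use c in \<open>auto simp: space_restrict_space\<close>)
  moreover have "\<forall>z1\<in>unit_disk. \<forall>z2\<in>unit_disk.
      norm (F z1 - F z2) \<le> 1 * omega \<alpha> (norm (z1 - z2))"
    using c by (simp add: omega_def)
  ultimately show ?thesis
    unfolding Lambda_infty_def by (auto intro!: exI[of _ 1])
qed

theorem theorem2p2:
  fixes f :: "complex \<Rightarrow> complex"
  assumes "f holomorphic_on unit_disk"
  shows "(\<not> f constant_on unit_disk \<longrightarrow>
            (\<forall>\<alpha>>1. modulus f \<notin> Lambda_infty (omega \<alpha>) \<and> f \<notin> Lambda_infty (omega \<alpha>))) \<and>
         (f constant_on unit_disk \<longrightarrow>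
            (\<forall>\<alpha>>0. modulus f \<in> Lambda_infty (omega \<alpha>) \<and> f \<in> Lambda_infty (omega \<alpha>)))"
proof -
  have modulus_constant: "modulus f constant_on unit_disk" if "f constant_on unit_disk"
    using that unfolding constant_on_def modulus_def by metis
  have f_constant: "f constant_on unit_disk" if "modulus f constant_on unit_disk"
  proof -
    have "(\<lambda>z. norm (f z)) constant_on unit_disk"
      using that unfolding constant_on_def modulus_def by (metis Re_complex_of_real)
    then show ?thesis
      using holomorphic_constant_norm_imp_constant_on[OF assms] by simp
  qed
  show ?thesis
    using f_constant modulus_constant Lambda_infty_gt_1_constant_on constant_on_imp_Lambda_infty
    by blast
qed

end
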